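(* Let $P$ be the set of prime numbers, let $t$ be a fixed complex number, and let $x$ be an indeterminate. Then, as an identity of formal Dirichlet series (in the formal variable $s$) with coefficients in $\mathbb{C}[x]$, $$\prod_{p\in P}\left[1+\sum_{m=1}^{\infty}\frac{(1+p^t+p^{2t}+\cdots+p^{mt})\,x}{p^{ms}}\right]=1+\sum_{N=2}^{\infty}\frac{\sigma_t(N)\,x^{\omega(N)}}{N^s},$$ where $\sigma_t(N)$ is the sum of the $t$-th powers of all positive divisors of $N$ (including $N$ itself), and $\omega(N)$ is the number of distinct prime divisors of $N$.
   Context: A formal Dirichlet series with coefficients in a commutative ring $R$ is a function $a:\{1,2,3,\dots\}\to R$, written $\sum_{n\ge1}a(n)/n^s$. Addition is termwise and multiplication is Dirichlet convolution, $(ab)(n)=\sum_{de=n}a(d)b(e)$. The series $1+\sum_{m\ge1}c_m/p^{ms}$ is the one with coefficient $1$ at $n=1$, coefficient $c_m$ at $n=p^m$, and $0$ elsewhere. An infinite product over primes is the coefficientwise limit of the finite products over $p\le y$ as $y\to\infty$, where for each $n$ the coefficient at $n$ is eventually constant in $y$. For a positive integer $d$, $d^t=\exp(t\log d)$. *)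

theory Defs
  imports "HOL-Analysis.Analysis" "HOL-Computational_Algebra.Computational_Algebra"
begin

text \<open>
  A formal Dirichlet series is a coefficient function on the positive integers. It is represented
  by a function on the naturals whose meaningless value at \<open>0\<close> is normalised to \<open>0\<close>, so that
  equality of series is equality of all coefficients at positive integers.
\<close>

typedef (overloaded) 'a fds = "{a :: nat \<Rightarrow> 'a :: zero. a 0 = 0}"
  morphisms fds_nth fds_Abs
  by (rule exI[of _ "\<lambda>_. 0"]) simp

definition fds :: "(nat \<Rightarrow> 'a :: zero) \<Rightarrow> 'a fds" where
  "fds a = fds_Abs (\<lambda>n. if n = 0 then 0 else a n)"

lemma fds_nth_0 [simp]: "fds_nth A 0 = 0"
  using fds_nth[of A] by simp

lemma fds_nth_fds: "fds_nth (fds a) n = (if n = 0 then 0 else a n)"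
  unfolding fds_def by (subst fds_Abs_inverse) auto

lemma fds_eqI: "(\<And>n. n > 0 \<Longrightarrow> fds_nth A n = fds_nth B n) \<Longrightarrow> A = B"
  by (metis fds_nth_0 fds_nth_inject ext gr0I)

lemma finite_mult_eq: "n > 0 \<Longrightarrow> finite {(d, e). d * e = (n :: nat)}"
  by (rule finite_subset[of _ "{..n} \<times> {..n}"]) auto

lemma convolution_assoc:
  fixes a b c :: "nat \<Rightarrow> 'a :: comm_ring_1"
  assumes "n > 0"
  shows "(\<Sum>(d, e) | d * e = n. (\<Sum>(u, v) | u * v = d. a u * b v) * c e) =
         (\<Sum>(d, e) | d * e = n. a d * (\<Sum>(u, v) | u * v = e. b u * c v))"
proof -
  have fin: "finite {(u, v). u * v = fst q}" "finite {(u, v). u * v = snd q}"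
    if "q \<in> {(d, e). d * e = n}" for q
    using that assms by (auto intro!: finite_mult_eq)
  have "(\<Sum>(d, e) | d * e = n. (\<Sum>(u, v) | u * v = d. a u * b v) * c e) =
      (\<Sum>q\<in>{(d, e). d * e = n}. \<Sum>r\<in>{(u, v). u * v = fst q}. a (fst r) * b (snd r) * c (snd q))"
    by (simp add: case_prod_unfold sum_distrib_right)
  also have "\<dots> = (\<Sum>(q, r)\<in>(SIGMA q:{(d, e). d * e = n}. {(u, v). u * v = fst q}).
                     a (fst r) * b (snd r) * c (snd q))"
    using fin assms by (intro sum.Sigma finite_mult_eq ballI) auto
  also have "\<dots> = (\<Sum>(q, r)\<in>(SIGMA q:{(d, e). d * e = n}. {(u, v). u * v = snd q}).
                     a (fst q) * (b (fst r) * c (snd r)))"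
    by (rule sum.reindex_bij_witness
          [of _ "\<lambda>(q, r). ((fst q * fst r, snd r), (fst q, fst r))"
              "\<lambda>(q, r). ((fst r, snd r * snd q), (snd r, snd q))"])
       (auto simp: algebra_simps)
  also have "\<dots> = (\<Sum>q\<in>{(d, e). d * e = n}. \<Sum>r\<in>{(u, v). u * v = snd q}.
                     a (fst q) * (b (fst r) * c (snd r)))"
    using fin assms by (intro sum.Sigma[symmetric] finite_mult_eq ballI) auto
  also have "\<dots> = (\<Sum>(d, e) | d * e = n. a d * (\<Sum>(u, v) | u * v = e. b u * c v))"
    by (simp add: case_prod_unfold sum_distrib_left)
  finally show ?thesis .
qed

lemma convolution_commute:
  fixes a b :: "nat \<Rightarrow> 'a :: comm_ring_1"
  shows "(\<Sum>(d, e) | d * e = n. a d * b e) = (\<Sum>(d, e) | d * e = n. b d * a e)"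
  by (rule sum.reindex_bij_witness[of _ prod.swap prod.swap]) (auto simp: mult.commute)

lemma convolution_1_left:
  fixes b :: "nat \<Rightarrow> 'a :: comm_ring_1"
  assumes "n > 0"
  shows "(\<Sum>(d, e) | d * e = n. (if d = 1 then 1 else 0) * b e) = b n"
proof -
  have "(\<Sum>(d, e) | d * e = n. (if d = 1 then 1 else 0) * b e) =
        (\<Sum>(d, e)\<in>{(1 :: nat, n)}. (if d = 1 then 1 else 0) * b e)"
    by (rule sum.mono_neutral_right) (use assms finite_mult_eq[of n] in \<open>auto split: if_splits\<close>)
  thus ?thesis by simp
qed

instantiation fds :: (comm_ring_1) comm_ring_1
begin

definition zero_fds :: "'a fds" where "0 = fds (\<lambda>_. 0)"
definition one_fds :: "'a fds" where "1 = fds (\<lambda>n. if n = 1 then 1 else 0)"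
definition plus_fds :: "'a fds \<Rightarrow> 'a fds \<Rightarrow> 'a fds" where
  "A + B = fds (\<lambda>n. fds_nth A n + fds_nth B n)"
definition uminus_fds :: "'a fds \<Rightarrow> 'a fds" where
  "- A = fds (\<lambda>n. - fds_nth A n)"
definition minus_fds :: "'a fds \<Rightarrow> 'a fds \<Rightarrow> 'a fds" where
  "A - B = fds (\<lambda>n. fds_nth A n - fds_nth B n)"
definition times_fds :: "'a fds \<Rightarrow> 'a fds \<Rightarrow> 'a fds" where
  "A * B = fds (\<lambda>n. \<Sum>(d, e) | d * e = n. fds_nth A d * fds_nth B e)"

lemma fds_nth_mult:
  "n > 0 \<Longrightarrow> fds_nth (A * B) n = (\<Sum>(d, e) | d * e = n. fds_nth A d * fds_nth B e)"
  for A B :: "'a fds"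
  by (simp add: times_fds_def fds_nth_fds)

instance
proof
  fix A B C :: "'a fds"
  show "A * B * C = A * (B * C)"
  proof (rule fds_eqI)
    fix n :: nat assume n: "n > 0"
    have "fds_nth (A * B * C) n =
      (\<Sum>(d, e) | d * e = n. (\<Sum>(u, v) | u * v = d. fds_nth A u * fds_nth B v) * fds_nth C e)"
      unfolding fds_nth_mult[OF n]
      by (rule sum.cong) (use n in \<open>auto simp: fds_nth_mult\<close>)
    also have "\<dots> = 
      (\<Sum>(d, e) | d * e = n. fds_nth A d * (\<Sum>(u, v) | u * v = e. fds_nth B u * fds_nth C v))"
      by (rule convolution_assoc[OF n])
    also have "\<dots> = fds_nth (A * (B * C)) n"
      unfolding fds_nth_mult[OF n]
      by (rule sum.cong) (use n in \<open>auto simp: fds_nth_mult\<close>)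
    finally show "fds_nth (A * B * C) n = fds_nth (A * (B * C)) n" .
  qed
  show "A * B = B * A"
    unfolding times_fds_def by (subst convolution_commute) (rule refl)
  show "1 * A = A"
  proof (rule fds_eqI)
    fix n :: nat assume n: "n > 0"
    have "fds_nth (1 * A) n = (\<Sum>(d, e) | d * e = n. (if d = 1 then 1 else 0) * fds_nth A e)"
      unfolding fds_nth_mult[OF n]
      by (rule sum.cong) (use n in \<open>auto simp: one_fds_def fds_nth_fds\<close>)
    thus "fds_nth (1 * A) n = fds_nth A n"
      using convolution_1_left[OF n, of "fds_nth A"] by simp
  qed
  show "(A + B) * C = A * C + B * C"
    by (rule fds_eqI)
       (auto simp: fds_nth_mult plus_fds_def fds_nth_fds case_prod_unfold sum.distrib[symmetric]
             algebra_simps intro!: sum.cong)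
  show "A + B + C = A + (B + C)" "A + B = B + A" "0 + A = A" "- A + A = 0" "A - B = A + - B"
    by (auto intro!: fds_eqI simp: plus_fds_def uminus_fds_def minus_fds_def zero_fds_def
          fds_nth_fds algebra_simps)
  have "fds_nth (0 :: 'a fds) 1 \<noteq> fds_nth 1 1"
    by (simp add: zero_fds_def one_fds_def fds_nth_fds)
  thus "(0 :: 'a fds) \<noteq> 1" by metis
qed

end

text \<open>The series \<open>1 + (\<Sum>m\<ge>1. c m / p\<^sup>m\<^sup>s)\<close>; the exponent \<open>m\<close> is unique for \<open>p \<ge> 2\<close>.\<close>

definition fds_prime_power :: "nat \<Rightarrow> (nat \<Rightarrow> 'a :: comm_ring_1) \<Rightarrow> 'a fds" where
  "fds_prime_power p c =
     fds (\<lambda>n. if n = 1 then 1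
              else if \<exists>m\<ge>1. n = p ^ m then c (THE m. n = p ^ m)
              else 0)"

lemma fds_nth_prime_power:
  assumes "prime p" "m \<ge> 1"
  shows "fds_nth (fds_prime_power p c) (p ^ m) = c m"
proof -
  have p: "p > 1" using assms(1) by (rule prime_gt_1_nat)
  have the: "(THE k. p ^ m = p ^ k) = m"
    using p by (intro the_equality) (auto simp: power_inject_exp)
  show ?thesis
    using assms p the by (auto simp: fds_prime_power_def fds_nth_fds)
qed

text \<open>
  \<open>F\<close> has product \<open>L\<close> over all primes: every coefficient of the partial products over
  \<open>p \<le> y\<close> is eventually constant in \<open>y\<close>, and equal to the corresponding coefficient of \<open>L\<close>.
\<close>

definition has_prime_product :: "(nat \<Rightarrow> 'a :: comm_ring_1 fds) \<Rightarrow> 'a fds \<Rightarrow> bool" where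
  "has_prime_product F L \<longleftrightarrow>
     (\<forall>n\<ge>1. \<forall>\<^sub>F y in at_top. fds_nth (\<Prod>p | prime p \<and> p \<le> (y :: nat). F p) n = fds_nth L n)"

text \<open>Complex \<open>powr\<close> uses the principal logarithm, which is the real one at positive integers.\<close>

definition divisor_sigma :: "complex \<Rightarrow> nat \<Rightarrow> complex" where
  "divisor_sigma t n = (\<Sum>d | d dvd n. of_nat d powr t)"

definition prime_omega :: "nat \<Rightarrow> nat" where
  "prime_omega n = card {p. prime p \<and> p dvd n}"

end

theory Submission
  imports Defs
begin

text \<open>
  The right-hand side has multiplicative coefficients \<open>g n = \<sigma>\<^sub>t(n) x\<^bsup>\<omega>(n)\<^esup>\<close>, and for any multiplicative \<open>g\<close>
  the product of the local factors over a finite set \<open>S\<close> of primes has coefficient \<open>g n\<close> at those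
  \<open>n\<close> all of whose prime factors lie in \<open>S\<close>, and \<open>0\<close> at the others. Multiplying by the factor of a
  new prime \<open>p\<close>, only the splitting of \<open>n\<close> into its \<open>p\<close>-part and the cofactor contributes to the
  convolution.
\<close>

lemma fds_nth_1: "fds_nth (1 :: 'a :: comm_ring_1 fds) n = (if n = 1 then 1 else 0)"
  by (simp add: one_fds_def fds_nth_fds)

lemma fds_nth_plus: "fds_nth (A + B) n = fds_nth A n + fds_nth B n"
  for A B :: "'a :: comm_ring_1 fds"
  by (simp add: plus_fds_def fds_nth_fds)

lemma fds_nth_prime_power_1 [simp]: "fds_nth (fds_prime_power p c) 1 = 1"
  by (simp add: fds_prime_power_def fds_nth_fds)

lemma fds_nth_prime_power_eq_0:
  assumes "\<And>m. n \<noteq> p ^ m"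
  shows "fds_nth (fds_prime_power p c) n = 0"
  \<comment> \<open>The exponent 0 rules out n = 1, where the coefficient is 1 rather than
    0.\<close>
  using assms assms[of 0] by (auto simp: fds_prime_power_def fds_nth_fds)

text \<open>In a nonzero term of the convolution the first index is a power of p and, since A
  vanishes at multiples of p, the second is prime to p. Comparing p-adic valuations leaves one
  term.\<close>

lemma fds_nth_prime_power_mult:
  fixes A :: "'a :: comm_ring_1 fds"
  assumes p: "prime p" and A: "\<And>n. p dvd n \<Longrightarrow> fds_nth A n = 0"
    and e: "\<not> p dvd e"
  shows "fds_nth (fds_prime_power p c * A) (p ^ k * e) =
         fds_nth (fds_prime_power p c) (p ^ k) * fds_nth A e"
proof -
  have pos: "p ^ k * e > 0"
    using p e by (auto simp: prime_gt_0_nat intro: Nat.gr0I)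
  have unique: "d = p ^ k \<and> e' = e"
    if de: "d * e' = p ^ k * e" and nz: "fds_nth (fds_prime_power p c) d * fds_nth A e' \<noteq> 0" for d e'
  proof -
    have "fds_nth (fds_prime_power p c) d \<noteq> 0" "fds_nth A e' \<noteq> 0"
      using nz by auto
    then obtain j where d: "d = p ^ j" and e': "\<not> p dvd e'"
      using fds_nth_prime_power_eq_0[of d p c] A by metis
    have "multiplicity p (p ^ j * e') = j" "multiplicity p (p ^ k * e) = k"
      using p e e' by (metis multiplicity_decomposeI not_prime_0)+
    hence "j = k"
      using de d by simp
    thus ?thesis
      using de d p by (auto simp: prime_gt_0_nat)
  qed
  have "fds_nth (fds_prime_power p c * A) (p ^ k * e) =
        (\<Sum>(d, e')\<in>{(p ^ k, e)}. fds_nth (fds_prime_power p c) d * fds_nth A e')"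
    unfolding fds_nth_mult[OF pos]
    using unique by (intro sum.mono_neutral_right finite_mult_eq[OF pos]) auto
  thus ?thesis by simp
qed

text \<open>Stated for arbitrary finite sets of primes, so that induction can adjoin one prime at a
  time in any order.\<close>

lemma fds_nth_prod_prime_power:
  fixes g :: "nat \<Rightarrow> 'a :: comm_ring_1"
  assumes g1: "g 1 = 1"
    and mult: "\<And>m n. m > 0 \<Longrightarrow> n > 0 \<Longrightarrow> coprime m n \<Longrightarrow> g (m * n) = g m * g n"
    and c: "\<And>p m. prime p \<Longrightarrow> m \<ge> 1 \<Longrightarrow> c p m = g (p ^ m)"
    and S: "finite S" "\<And>p. p \<in> S \<Longrightarrow> prime p"
    and n: "n > 0"
  shows "fds_nth (\<Prod>p\<in>S. fds_prime_power p (c p)) n = (if prime_factors n \<subseteq> S then g n else 0)"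
  using S n
proof (induction S arbitrary: n rule: finite_induct)
  case empty
  have "prime_factors n = {} \<longleftrightarrow> n = 1"
    using empty.prems by (auto simp: prime_factorization_empty_iff)
  thus ?case using g1 by (auto simp: fds_nth_1)
next
  case (insert p S)
  have p: "prime p" using insert.prems by simp
  define A where "A = (\<Prod>p\<in>S. fds_prime_power p (c p))"
  have A: "fds_nth A n = (if prime_factors n \<subseteq> S then g n else 0)" if "n > 0" for n
    unfolding A_def using insert.prems that by (intro insert.IH) auto
  \<comment> \<open>A multiple of p has a prime factor outside S; at index 0 the coefficient is 0 by
    normalisation.\<close>
  have A0: "fds_nth A n = 0" if "p dvd n" for n
    using A[of n] that p \<open>p \<notin> S\<close> by (cases "n = 0") (auto simp: in_prime_factors_iff)
  obtain k e where n: "n = p ^ k * e" and e: "\<not> p dvd e"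
    using insert.prems p multiplicity_decompose'[of n p]
    by (metis not_gr_zero not_prime_unit)
  have e0: "e > 0" using e by (auto intro: Nat.gr0I)
  \<comment> \<open>For k = 0 the coefficient is the leading 1 of the factor, not
    \<open>c p 0\<close>, and it is matched by \<open>g 1 = 1\<close>.\<close>
  have Fp: "fds_nth (fds_prime_power p (c p)) (p ^ k) = g (p ^ k)"
    using fds_nth_prime_power[OF p, of k "c p"] c[OF p, of k] g1
      fds_nth_prime_power_1[of p "c p"] by (cases "k = 0") auto
  have "coprime (p ^ k) e"
    using p e by (simp add: prime_imp_coprime)
  hence gn: "g n = g (p ^ k) * g e"
    using n mult p e0 by (simp add: prime_gt_0_nat)
  have "q = p" if "prime q" "q dvd p ^ k" for q
    using that p by (meson prime_dvd_power primes_dvd_imp_eq)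
  \<comment> \<open>Removing p treats k = 0 and k > 0 alike, as p may or may not divide n.\<close>
  hence "prime_factors n - {p} = prime_factors e"
    using p e e0 n by (auto simp: in_prime_factors_iff prime_dvd_mult_iff prime_gt_0_nat)
  hence "prime_factors n \<subseteq> insert p S \<longleftrightarrow> prime_factors e \<subseteq> S"
    by blast
  moreover have "fds_nth (\<Prod>q\<in>insert p S. fds_prime_power q (c q)) n = g (p ^ k) * fds_nth A e"
    using insert.hyps fds_nth_prime_power_mult[OF p A0 e] by (simp add: A_def n Fp)
  ultimately show ?case
    using A[OF e0] gn by simp
qed

lemma has_prime_product_multiplicative:
  fixes g :: "nat \<Rightarrow> 'a :: comm_ring_1"
  assumes "g 1 = 1"
    and "\<And>m n. m > 0 \<Longrightarrow> n > 0 \<Longrightarrow> coprime m n \<Longrightarrow> g (m * n) = g m * g n"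
    and "\<And>p m. prime p \<Longrightarrow> m \<ge> 1 \<Longrightarrow> c p m = g (p ^ m)"
  shows "has_prime_product (\<lambda>p. fds_prime_power p (c p)) (fds g)"
  unfolding has_prime_product_def
proof (intro allI impI)
  fix n :: nat assume n: "n \<ge> 1"
  show "\<forall>\<^sub>F y in at_top.
      fds_nth (\<Prod>p | prime p \<and> p \<le> y. fds_prime_power p (c p)) n = fds_nth (fds g) n"
    \<comment> \<open>Prime factors of n are at most n, so the coefficient is stable from y = n
      on.\<close>
    using eventually_ge_at_top[of n]
  proof eventually_elim
    case (elim y)
    have "prime_factors n \<subseteq> {p. prime p \<and> p \<le> y}"
      using n elim by (auto simp: in_prime_factors_iff intro: order.trans[OF dvd_imp_le])
    moreover have "fds_nth (\<Prod>p | prime p \<and> p \<le> y. fds_prime_power p (c p)) n =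
        (if prime_factors n \<subseteq> {p. prime p \<and> p \<le> y} then g n else 0)"
      using n by (intro fds_nth_prod_prime_power assms) auto
    ultimately show ?case
      using n by (simp only: fds_nth_fds) simp
  qed
qed

text \<open>Complex powers are not multiplicative in the base in general; here the bases are
  nonnegative reals, where the principal logarithm causes no branch problem.\<close>

lemma powr_of_nat_mult: "of_nat (m * n) powr t = of_nat m powr t * (of_nat n powr t :: complex)"
  using powr_times_real[of "of_nat m" "of_nat n" t] by simp

text \<open>Positivity of p matters at j = 0, because \<open>0 powr 0 = 0\<close>.\<close>

lemma powr_of_nat_power:
  assumes "p > 0"
  shows "of_nat (p ^ j) powr t = of_nat p powr (of_nat j * t :: complex)"
proof (induction j)
  case (Suc j)
  thus ?case
    using powr_of_nat_mult[of p "p ^ j" t] by (simp add: powr_add distrib_right)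
qed (use assms in auto)

text \<open>For coprime m and n, multiplication of divisors is a bijection from pairs onto the
  divisors of the product; its inverse takes the gcd with m and with n.\<close>

lemma divisor_sigma_mult:
  assumes "m > 0" "n > 0" "coprime m n"
  shows "divisor_sigma t (m * n) = divisor_sigma t m * divisor_sigma t n"
proof -
  have gcds: "gcd (a * b) m = a" "gcd (a * b) n = b" if "a dvd m" "b dvd n" for a b
  proof -
    have "coprime b m" "coprime a n"
      using that assms by (meson coprime_divisors coprime_commute dvd_refl)+
    thus "gcd (a * b) m = a" "gcd (a * b) n = b"
      using that by (simp_all add: gcd_mult_left_right_cancel gcd_mult_left_left_cancel
          gcd_proj1_iff coprime_commute)
  qed
  have "divisor_sigma t m * divisor_sigma t n =
      (\<Sum>(a, b)\<in>{a. a dvd m} \<times> {b. b dvd n}. of_nat (a * b) powr t)"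
    unfolding divisor_sigma_def
    by (simp add: sum_product sum.cartesian_product powr_of_nat_mult del: of_nat_mult)
  also have "\<dots> = (\<Sum>d | d dvd m * n. of_nat d powr t)"
  proof (rule sum.reindex_bij_witness[of _ "\<lambda>d. (gcd d m, gcd d n)" "\<lambda>(a, b). a * b"])
    fix d assume "d \<in> {d. d dvd m * n}"
    then obtain a b where "d = a * b" "a dvd m" "b dvd n"
      using division_decomp by blast
    thus "(case (gcd d m, gcd d n) of (a, b) \<Rightarrow> a * b) = d"
      by (simp add: gcds)
  qed (auto intro: mult_dvd_mono simp: gcds)
  finally show ?thesis
    by (simp add: divisor_sigma_def)
qed

lemma divisor_sigma_prime_power:
  assumes "prime p"
  shows "divisor_sigma t (p ^ m) = (\<Sum>j=0..m. of_nat p powr (of_nat j * t))"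
proof -
  have "{d. d dvd p ^ m} = (\<lambda>j. p ^ j) ` {0..m}"
    using divides_primepow_nat[OF assms] by auto
  moreover have "inj_on (\<lambda>j. p ^ j) {0..m}"
    using prime_gt_1_nat[OF assms] by (auto intro!: inj_onI)
  ultimately show ?thesis
    using prime_gt_0_nat[OF assms]
    by (simp add: divisor_sigma_def sum.reindex powr_of_nat_power del: of_nat_power)
qed

lemma prime_omega_mult:
  assumes "m > 0" "n > 0" "coprime m n"
  shows "prime_omega (m * n) = prime_omega m + prime_omega n"
proof -
  have "{p. prime p \<and> p dvd m * n} = {p. prime p \<and> p dvd m} \<union> {p. prime p \<and> p dvd n}"
    by (auto simp: prime_dvd_mult_iff)
  moreover have "{p. prime p \<and> p dvd m} \<inter> {p. prime p \<and> p dvd n} = {}"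
    using coprime_common_divisor[OF assms(3)] not_prime_unit by blast
  moreover have "finite {p. prime p \<and> p dvd k}" if "k > 0" for k :: nat
    using that by (intro finite_subset[OF _ finite_divisors_nat]) auto
  ultimately show ?thesis
    using assms(1,2) by (simp add: prime_omega_def card_Un_disjoint)
qed

lemma prime_omega_prime_power:
  assumes "prime p" "m \<ge> 1"
  shows "prime_omega (p ^ m) = 1"
proof -
  have "{q. prime q \<and> q dvd p ^ m} = {p}"
    using assms by (auto simp: prime_dvd_power_iff primes_dvd_imp_eq)
  thus ?thesis by (simp add: prime_omega_def)
qed

theorem lemmaB:
  fixes t :: complex
  shows "has_prime_product
           (\<lambda>p. fds_prime_power p (\<lambda>m. smult (\<Sum>j=0..m. of_nat p powr (of_nat j * t)) [:0, 1:]))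
           (1 + fds (\<lambda>N. if N \<ge> 2 then smult (divisor_sigma t N) ([:0, 1:] ^ prime_omega N) else 0))"
proof -
  \<comment> \<open>At 1 this formula gives 1, so g absorbs the separate leading term of the
    right-hand side.\<close>
  define g where "g n = smult (divisor_sigma t n) ([:0, 1:] ^ prime_omega n)" for n
  have "prime_omega 1 = 0"
    by (auto simp: prime_omega_def)
  hence g1: "g 1 = 1"
    by (simp add: g_def divisor_sigma_def)
  have "1 + fds (\<lambda>N. if N \<ge> 2 then smult (divisor_sigma t N) ([:0, 1:] ^ prime_omega N) else 0)
      = fds g"
  proof (rule fds_eqI)
    fix n :: nat assume "n > 0"
    hence "n = 1 \<or> n \<ge> 2" by linarith
    thus "fds_nth (1 + fds (\<lambda>N. if N \<ge> 2
        then smult (divisor_sigma t N) ([:0, 1:] ^ prime_omega N) else 0)) n = fds_nth (fds g) n"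
      using g1 by (auto simp: fds_nth_plus fds_nth_1 fds_nth_fds g_def)
  qed
  moreover have "has_prime_product
      (\<lambda>p. fds_prime_power p (\<lambda>m. smult (\<Sum>j=0..m. of_nat p powr (of_nat j * t)) [:0, 1:])) (fds g)"
  proof (rule has_prime_product_multiplicative)
    show "g (m * n) = g m * g n" if "m > 0" "n > 0" "coprime m n" for m n
      using that by (simp add: g_def divisor_sigma_mult prime_omega_mult power_add mult.commute)
    \<comment> \<open>A prime power has a single prime divisor, so x occurs to the first power for
      every m.\<close>
    show "smult (\<Sum>j=0..m. of_nat p powr (of_nat j * t)) [:0, 1:] = g (p ^ m)"
      if "prime p" "m \<ge> 1" for p m
      using that by (simp add: g_def divisor_sigma_prime_power prime_omega_prime_power)
  qed (fact g1)
  ultimately show ?thesis by simp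
qed

end
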